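(* Let $\Omega,\Omega'\subset\mathbb{H}_1$ be open, let $f=(F,f_3):\Omega\to\mathbb{H}_1$ be a smooth positively oriented contact mapping and let $g=(G,g_3):\Omega'\to\Omega$ be a positively oriented conformal mapping. Then $$S_{CL}(f\circ g)=(S_{CL}(f)\circ g)\,(ZG)^2+S_{CL}(g)\quad\text{on }\Omega'.$$
   Context: The Heisenberg group $\mathbb{H}_1$ is $\mathbb{C}\times\mathbb{R}$ with coordinates $(z,t)$, $z=x+iy$, and product $(z_1,t_1)(z_2,t_2)=(z_1+z_2,\,t_1+t_2+2\,\mathrm{Im}(z_1\bar z_2))$. Put $X=\partial_x+2y\,\partial_t$, $Y=\partial_y-2x\,\partial_t$, $Z=\frac12(X-iY)$, $\bar Z=\frac12(X+iY)$, $\theta=dt-2y\,dx+2x\,dy$. A local diffeomorphism $f=(f_1+if_2,f_3)=(F,f_3)$ is contact if $f^*\theta=\lambda_f\theta$ with $\lambda_f$ nowhere zero; then $\lambda_f=|ZF|^2-|\bar ZF|^2$. It is positively oriented if $\lambda_f>0$ (so then $ZF\neq0$). A contact map is conformal if $(Xf_1)^2+(Xf_2)^2=(Yf_1)^2+(Yf_2)^2$ and $(Xf_1)(Yf_1)+(Xf_2)(Yf_2)=0$; a positively oriented contact map is conformal iff $\bar ZF=0$, and conformal maps are known to be $C^\infty$. The classical type Schwarzian derivative of a contact map $f=(F,f_3)$ is, at points where $ZF\neq0$, $$S_{CL}(f)=\frac{Z^3F}{ZF}-\frac32\left(\frac{Z^2F}{ZF}\right)^2 .$$ *)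

theory Defs
  imports "HOL-Analysis.Analysis"
begin

section \<open>Regularity\<close>

text \<open>Class \<open>C\<^sup>k\<close> on an open subset of a finite-dimensional space: all iterated directional
  derivatives up to order \<open>k\<close> exist and are continuous.  The definition is meant for open
  sets only, since the derivatives are full derivatives at the points of the set.\<close>

primrec Ck_on :: "nat \<Rightarrow> ('a::euclidean_space \<Rightarrow> 'b::real_normed_vector) \<Rightarrow> 'a set \<Rightarrow> bool" where
  "Ck_on 0 f S \<longleftrightarrow> continuous_on S f"
| "Ck_on (Suc k) f S \<longleftrightarrow>
     (\<forall>x\<in>S. f differentiable (at x)) \<and>
     (\<forall>v. Ck_on k (\<lambda>x. frechet_derivative f (at x) v) S)"

definition smooth_on :: "'a set \<Rightarrow> ('a::euclidean_space \<Rightarrow> 'b::real_normed_vector) \<Rightarrow> bool" where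
  "smooth_on S f \<longleftrightarrow> (\<forall>k. Ck_on k f S)"

text \<open>Local diffeomorphisms are only required to be of class \<open>C\<^sup>1\<close>; higher regularity is always
  stated separately.  A \<open>C\<^sup>\<infinity>\<close> local diffeomorphism in this sense has \<open>C\<^sup>\<infinity>\<close> local inverses by the
  inverse function theorem.\<close>

definition local_diffeo_on ::
  "'a set \<Rightarrow> ('a::euclidean_space \<Rightarrow> 'b::euclidean_space) \<Rightarrow> bool" where
  "local_diffeo_on S f \<longleftrightarrow>
     (\<forall>p\<in>S. \<exists>U h. open U \<and> p \<in> U \<and> U \<subseteq> S \<and> open (f ` U) \<and>
        Ck_on 1 f U \<and> Ck_on 1 h (f ` U) \<and> (\<forall>q\<in>U. h (f q) = q))"


section \<open>The Heisenberg group\<close>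

type_synonym heis = "complex \<times> real"

text \<open>A tangent vector at \<open>(z, t)\<close> is written as an element \<open>(w, s)\<close> of \<open>heis\<close>, standing for
  \<open>Re w \<partial>\<^sub>x + Im w \<partial>\<^sub>y + s \<partial>\<^sub>t\<close>.  Thus \<open>X = \<partial>\<^sub>x + 2y \<partial>\<^sub>t\<close> and \<open>Y = \<partial>\<^sub>y - 2x \<partial>\<^sub>t\<close> are the
  directions below.\<close>

definition X_field :: "(heis \<Rightarrow> 'b::real_normed_vector) \<Rightarrow> heis \<Rightarrow> 'b" where
  "X_field u p = frechet_derivative u (at p) (1, 2 * Im (fst p))"

definition Y_field :: "(heis \<Rightarrow> 'b::real_normed_vector) \<Rightarrow> heis \<Rightarrow> 'b" where
  "Y_field u p = frechet_derivative u (at p) (\<i>, - 2 * Re (fst p))"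

definition Z_field :: "(heis \<Rightarrow> complex) \<Rightarrow> heis \<Rightarrow> complex" where
  "Z_field u p = (X_field u p - \<i> * Y_field u p) / 2"

text \<open>\<open>\<theta> = dt - 2y dx + 2x dy\<close>\<close>

definition theta :: "heis \<Rightarrow> heis \<Rightarrow> real" where
  "theta p v = snd v - 2 * Im (fst p) * Re (fst v) + 2 * Re (fst p) * Im (fst v)"

definition theta_pullback :: "(heis \<Rightarrow> heis) \<Rightarrow> heis \<Rightarrow> heis \<Rightarrow> real" where
  "theta_pullback f p v = theta (f p) (frechet_derivative f (at p) v)"


section \<open>Contact and conformal mappings\<close>

definition contact_with :: "heis set \<Rightarrow> (heis \<Rightarrow> heis) \<Rightarrow> (heis \<Rightarrow> real) \<Rightarrow> bool" where
  "contact_with \<Omega> f lam \<longleftrightarrow>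
     local_diffeo_on \<Omega> f \<and>
     (\<forall>p\<in>\<Omega>. lam p \<noteq> 0 \<and> (\<forall>v. theta_pullback f p v = lam p * theta p v))"

definition contact_map :: "heis set \<Rightarrow> (heis \<Rightarrow> heis) \<Rightarrow> bool" where
  "contact_map \<Omega> f \<longleftrightarrow> (\<exists>lam. contact_with \<Omega> f lam)"

text \<open>The factor is unique on \<open>\<Omega>\<close>, because \<open>\<theta>\<close> takes the value 1 on \<open>\<partial>\<^sub>t\<close>.\<close>

definition pos_contact_map :: "heis set \<Rightarrow> (heis \<Rightarrow> heis) \<Rightarrow> bool" where
  "pos_contact_map \<Omega> f \<longleftrightarrow> (\<exists>lam. contact_with \<Omega> f lam \<and> (\<forall>p\<in>\<Omega>. lam p > 0))"

definition conformal_map :: "heis set \<Rightarrow> (heis \<Rightarrow> heis) \<Rightarrow> bool" where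
  "conformal_map \<Omega> f \<longleftrightarrow>
     contact_map \<Omega> f \<and>
     (let f1 = (\<lambda>p. Re (fst (f p))); f2 = (\<lambda>p. Im (fst (f p))) in
      \<forall>p\<in>\<Omega>.
        (X_field f1 p)\<^sup>2 + (X_field f2 p)\<^sup>2 = (Y_field f1 p)\<^sup>2 + (Y_field f2 p)\<^sup>2 \<and>
        X_field f1 p * Y_field f1 p + X_field f2 p * Y_field f2 p = 0)"


section \<open>The classical type Schwarzian derivative\<close>

text \<open>Only meaningful at points where \<open>Z F \<noteq> 0\<close>, with \<open>F = fst \<circ> f\<close>.\<close>

definition S_CL :: "(heis \<Rightarrow> heis) \<Rightarrow> heis \<Rightarrow> complex" where
  "S_CL f p =
     (let F = fst \<circ> f in
      Z_field (Z_field (Z_field F)) p / Z_field F p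
      - 3 / 2 * (Z_field (Z_field F) p / Z_field F p)\<^sup>2)"

end

theory Submission
  imports Defs
begin

text \<open>For a conformal \<open>g = (G, g\<^sub>3)\<close> of positive orientation \<open>G\<close> satisfies a Cauchy--Riemann
  equation, so that \<open>Z (u \<circ> g) = Z G \<cdot> (Z u \<circ> g)\<close> for every differentiable \<open>u\<close>.  Thus \<open>Z\<close>
  behaves like the complex derivative in the classical Schwarzian chain rule: three
  applications to \<open>F \<circ> g\<close>, with \<open>Z F\<close> and \<open>Z G\<close> nonvanishing by positivity of the contact
  factors, give the formula.\<close>

section \<open>Calculus of smooth functions\<close>

lemma frechet_derivative_eqI:
  "(f has_derivative f') (at x) \<Longrightarrow> frechet_derivative f (at x) = f'"
  using frechet_derivative_at by metis

lemma has_frechet_derivative: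
  "f differentiable (at x) \<Longrightarrow> (f has_derivative frechet_derivative f (at x)) (at x)"
  by (simp add: frechet_derivative_works)

text \<open>On an open set, agreement on the set forces agreement of the full derivatives at its
  points, so the induction can descend to the derivatives. This is what allows the derivative of a
  sum or product to be replaced by its explicit formula on \<open>S\<close>.\<close>

lemma Ck_on_cong:
  assumes "open S" "\<And>x. x \<in> S \<Longrightarrow> f x = g x" "Ck_on k f S"
  shows "Ck_on k g S"
  using assms(2,3)
proof (induction k arbitrary: f g)
  case 0
  then show ?case by (metis Ck_on.simps(1) continuous_on_cong)
next
  case (Suc k)
  have g: "(g has_derivative frechet_derivative f (at x)) (at x)" if "x \<in> S" for x
    using Suc.prems that
    by (intro has_derivative_transform_within_open[OF has_frechet_derivative assms(1) that]) auto
  have "Ck_on k (\<lambda>x. frechet_derivative g (at x) v) S" for v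
  proof (rule Suc.IH)
    show "frechet_derivative f (at x) v = frechet_derivative g (at x) v" if "x \<in> S" for x
      using frechet_derivative_eqI[OF g[OF that]] by simp
    show "Ck_on k (\<lambda>x. frechet_derivative f (at x) v) S"
      using Suc.prems(2) by simp
  qed
  with g show ?case by (auto simp: differentiable_def)
qed

text \<open>Differentiability gives continuity at the bottom level, and induction lifts this. Needed
  in the Leibniz rule, where the undifferentiated factor must be lowered to the class of the
  differentiated one.\<close>

lemma Ck_on_Suc_imp: "Ck_on (Suc k) f S \<Longrightarrow> Ck_on k f S"
proof (induction k arbitrary: f)
  case 0
  then show ?case
    by (auto intro!: continuous_at_imp_continuous_on differentiable_imp_continuous_within)
next
  case (Suc k)
  have "Ck_on k (\<lambda>x. frechet_derivative f (at x) v) S" for v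
    using Suc.prems by (intro Suc.IH) simp
  with Suc.prems show ?case by simp
qed

lemma Ck_on_const: "Ck_on k (\<lambda>x. c) S"
  by (induction k arbitrary: c) auto

lemma Ck_on_linear: "bounded_linear L \<Longrightarrow> Ck_on k L S"
proof (cases k)
  case (Suc n)
  assume L: "bounded_linear L"
  then have "frechet_derivative L (at x) = L" for x
    by (intro frechet_derivative_eqI bounded_linear_imp_has_derivative)
  with Suc L show ?thesis
    by (auto simp: Ck_on_const bounded_linear_imp_differentiable)
qed (simp add: linear_continuous_on)

lemma Ck_on_add:
  assumes "open S" "Ck_on k f S" "Ck_on k g S"
  shows "Ck_on k (\<lambda>x. f x + g x) S"
  using assms(2,3)
proof (induction k arbitrary: f g)
  case (Suc k)
  have D: "((\<lambda>x. f x + g x) has_derivative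
      (\<lambda>v. frechet_derivative f (at x) v + frechet_derivative g (at x) v)) (at x)"
    if "x \<in> S" for x
    using that Suc.prems by (intro has_derivative_add has_frechet_derivative) auto
  have "Ck_on k (\<lambda>x. frechet_derivative f (at x) v + frechet_derivative g (at x) v) S" for v
    using Suc.prems by (intro Suc.IH) auto
  then have "Ck_on k (\<lambda>x. frechet_derivative (\<lambda>x. f x + g x) (at x) v) S" for v
    by (rule Ck_on_cong[OF assms(1), rotated]) (simp add: frechet_derivative_eqI[OF D])
  with D show ?case by (auto simp: differentiable_def)
qed (auto intro: continuous_on_add)

text \<open>By the Leibniz rule the derivative of a product is a sum of two products of the same
  bilinear kind, with factors of class one lower, so the induction closes. It is used for scalar
  multiplication, which carries the variable coefficients of \<open>X\<close> and
  \<open>Y\<close>.\<close>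

lemma (in bounded_bilinear) Ck_on:
  assumes "open S" "Ck_on k f S" "Ck_on k g S"
  shows "Ck_on k (\<lambda>x. prod (f x) (g x)) S"
  using assms(2,3)
proof (induction k arbitrary: f g)
  case (Suc k)
  have D: "((\<lambda>x. prod (f x) (g x)) has_derivative
      (\<lambda>v. prod (f x) (frechet_derivative g (at x) v) + prod (frechet_derivative f (at x) v) (g x)))
      (at x)" if "x \<in> S" for x
    using that Suc.prems by (intro FDERIV has_frechet_derivative) auto
  have "Ck_on k (\<lambda>x. prod (f x) (frechet_derivative g (at x) v) +
      prod (frechet_derivative f (at x) v) (g x)) S" for v
    using Suc.prems by (intro Ck_on_add[OF assms(1)] Suc.IH) (auto intro: Ck_on_Suc_imp)
  then have "Ck_on k (\<lambda>x. frechet_derivative (\<lambda>x. prod (f x) (g x)) (at x) v) S" for v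
    by (rule Ck_on_cong[OF assms(1), rotated]) (simp add: frechet_derivative_eqI[OF D])
  with D show ?case by (auto simp: differentiable_def)
qed (auto intro: continuous_on)

lemma Ck_on_compose_linear:
  assumes "open S" "bounded_linear L" "Ck_on k f S"
  shows "Ck_on k (\<lambda>x. L (f x)) S"
  using assms(3)
proof (induction k arbitrary: f)
  case 0
  then show ?case using assms(2) by (auto intro: bounded_linear.continuous_on)
next
  case (Suc k)
  have D: "((\<lambda>x. L (f x)) has_derivative (\<lambda>v. L (frechet_derivative f (at x) v))) (at x)"
    if "x \<in> S" for x
    using that Suc.prems by (intro bounded_linear.has_derivative[OF assms(2)] has_frechet_derivative) auto
  have "Ck_on k (\<lambda>x. L (frechet_derivative f (at x) v)) S" for v
    using Suc.prems by (intro Suc.IH) auto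
  then have "Ck_on k (\<lambda>x. frechet_derivative (\<lambda>x. L (f x)) (at x) v) S" for v
    by (rule Ck_on_cong[OF assms(1), rotated]) (simp add: frechet_derivative_eqI[OF D])
  with D show ?case by (auto simp: differentiable_def)
qed

section \<open>Closure properties of smooth functions\<close>

lemma smooth_on_cong:
  "open S \<Longrightarrow> (\<And>x. x \<in> S \<Longrightarrow> f x = g x) \<Longrightarrow> smooth_on S f \<Longrightarrow> smooth_on S g"
  unfolding smooth_on_def by (metis Ck_on_cong)

lemma smooth_on_differentiable: "smooth_on S f \<Longrightarrow> x \<in> S \<Longrightarrow> f differentiable (at x)"
  unfolding smooth_on_def using Ck_on.simps(2) by blast

lemma smooth_on_continuous: "smooth_on S f \<Longrightarrow> continuous_on S f"
  unfolding smooth_on_def using Ck_on.simps(1) by blast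

lemma smooth_on_frechet_derivative:
  "smooth_on S f \<Longrightarrow> smooth_on S (\<lambda>x. frechet_derivative f (at x) v)"
  unfolding smooth_on_def using Ck_on.simps(2) by blast

lemma smooth_on_linear: "bounded_linear L \<Longrightarrow> smooth_on S L"
  by (simp add: smooth_on_def Ck_on_linear)

lemma smooth_on_add:
  "open S \<Longrightarrow> smooth_on S f \<Longrightarrow> smooth_on S g \<Longrightarrow> smooth_on S (\<lambda>x. f x + g x)"
  by (simp add: smooth_on_def Ck_on_add)

lemma smooth_on_compose_linear:
  "open S \<Longrightarrow> bounded_linear L \<Longrightarrow> smooth_on S f \<Longrightarrow> smooth_on S (\<lambda>x. L (f x))"
  by (simp add: smooth_on_def Ck_on_compose_linear)

lemma smooth_on_scaleR:
  "open S \<Longrightarrow> smooth_on S a \<Longrightarrow> smooth_on S f \<Longrightarrow> smooth_on S (\<lambda>x. a x *\<^sub>R f x)"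
  by (simp add: smooth_on_def bounded_bilinear.Ck_on[OF bounded_bilinear_scaleR])


section \<open>Symmetry of second derivatives\<close>

text \<open>Two applications of the mean value theorem: first along \<open>v\<close> to the
  increment of \<open>u\<close> in direction \<open>w\<close>, then along \<open>w\<close> to the
  derivative of \<open>u\<close> in direction \<open>v\<close>. Each contributes one factor
  \<open>h\<close>.\<close>

lemma second_difference_mvt:
  fixes u :: "'a::real_normed_vector \<Rightarrow> real"
  assumes h: "h > 0"
    and S: "\<And>s t. 0 \<le> s \<Longrightarrow> s \<le> h \<Longrightarrow> 0 \<le> t \<Longrightarrow> t \<le> h \<Longrightarrow> p + s *\<^sub>R v + t *\<^sub>R w \<in> S"
    and u: "\<And>x. x \<in> S \<Longrightarrow> u differentiable (at x)"
    and uv: "\<And>x. x \<in> S \<Longrightarrow> (\<lambda>x. frechet_derivative u (at x) v) differentiable (at x)"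
  obtains s t where "0 < s" "s < h" "0 < t" "t < h"
    "u (p + h *\<^sub>R v + h *\<^sub>R w) - u (p + h *\<^sub>R v) - u (p + h *\<^sub>R w) + u p =
     h\<^sup>2 * frechet_derivative (\<lambda>x. frechet_derivative u (at x) v) (at (p + s *\<^sub>R v + t *\<^sub>R w)) w"
proof -
  \<comment> \<open>The summand \<open>0 *\<^sub>R w\<close> is kept so that both terms are
    instances of one differentiation formula, with \<open>t = h\<close> and
    \<open>t = 0\<close>.\<close>
  define \<phi> where "\<phi> s = u (p + s *\<^sub>R v + h *\<^sub>R w) - u (p + s *\<^sub>R v + 0 *\<^sub>R w)" for s
  define d where "d x = frechet_derivative u (at x) v" for x
  have "(\<phi> has_real_derivative (d (p + s *\<^sub>R v + h *\<^sub>R w) - d (p + s *\<^sub>R v + 0 *\<^sub>R w))) (at s)"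
    if "0 \<le> s" "s \<le> h" for s
  proof -
    have *: "((\<lambda>s. u (p + s *\<^sub>R v + t *\<^sub>R w)) has_real_derivative d (p + s *\<^sub>R v + t *\<^sub>R w)) (at s)"
      if t: "0 \<le> t" "t \<le> h" for t
    proof -
      have u': "u differentiable (at (p + s *\<^sub>R v + t *\<^sub>R w))"
        using S \<open>0 \<le> s\<close> \<open>s \<le> h\<close> t u by blast
      have "((\<lambda>s. p + s *\<^sub>R v + t *\<^sub>R w) has_derivative (\<lambda>r. r *\<^sub>R v)) (at s)"
        by (auto intro!: derivative_eq_intros)
      from diff_chain_at[OF this has_frechet_derivative[OF u']]
      show ?thesis
        using linear_frechet_derivative[OF u']
        by (simp add: has_field_derivative_def o_def d_def linear_scale mult.commute[of _ "frechet_derivative u _ v"])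
    qed
    show ?thesis unfolding \<phi>_def using *[of h] *[of 0] h by (intro DERIV_diff) auto
  qed
  from MVT2[OF h this] obtain s where s: "0 < s" "s < h"
    "\<phi> h - \<phi> 0 = h * (d (p + s *\<^sub>R v + h *\<^sub>R w) - d (p + s *\<^sub>R v + 0 *\<^sub>R w))"
    by auto
  have "((\<lambda>t. d (p + s *\<^sub>R v + t *\<^sub>R w)) has_real_derivative
      frechet_derivative d (at (p + s *\<^sub>R v + t *\<^sub>R w)) w) (at t)" if "0 \<le> t" "t \<le> h" for t
  proof -
    have d': "d differentiable (at (p + s *\<^sub>R v + t *\<^sub>R w))"
      using S s that uv unfolding d_def by simp
    have "((\<lambda>t. p + s *\<^sub>R v + t *\<^sub>R w) has_derivative (\<lambda>r. r *\<^sub>R w)) (at t)"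
      by (auto intro!: derivative_eq_intros)
    from diff_chain_at[OF this has_frechet_derivative[OF d']]
    show ?thesis
      using linear_frechet_derivative[OF d']
      by (simp add: has_field_derivative_def o_def linear_scale mult.commute[of _ "frechet_derivative d _ w"])
  qed
  from MVT2[OF h this] obtain t where t: "0 < t" "t < h"
    "d (p + s *\<^sub>R v + h *\<^sub>R w) - d (p + s *\<^sub>R v + 0 *\<^sub>R w) =
     h * frechet_derivative d (at (p + s *\<^sub>R v + t *\<^sub>R w)) w"
    by auto
  have "u (p + h *\<^sub>R v + h *\<^sub>R w) - u (p + h *\<^sub>R v) - u (p + h *\<^sub>R w) + u p = \<phi> h - \<phi> 0"
    by (simp add: \<phi>_def)
  also have "\<dots> = h\<^sup>2 * frechet_derivative d (at (p + s *\<^sub>R v + t *\<^sub>R w)) w"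
    using s(3) t(3) by (simp add: power2_eq_square)
  finally show ?thesis
    using that s t by (simp add: d_def[abs_def])
qed

text \<open>The second difference over a small parallelogram is symmetric in \<open>v\<close> and
  \<open>w\<close>, so after division by the square of \<open>h\<close> it is a value of either
  mixed derivative at some point near \<open>p\<close>. Continuity of both mixed derivatives at
  \<open>p\<close> then identifies them.\<close>

lemma second_derivative_symmetric:
  fixes u :: "'a::euclidean_space \<Rightarrow> real"
  assumes "open S" "p \<in> S" "smooth_on S u"
  shows "frechet_derivative (\<lambda>x. frechet_derivative u (at x) v) (at p) w =
    frechet_derivative (\<lambda>x. frechet_derivative u (at x) w) (at p) v"
proof -
  define A where "A x = frechet_derivative (\<lambda>x. frechet_derivative u (at x) v) (at x) w" for x
  define B where "B x = frechet_derivative (\<lambda>x. frechet_derivative u (at x) w) (at x) v" for x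
  have "smooth_on S A" "smooth_on S B"
    unfolding A_def B_def using assms(3) by (intro smooth_on_frechet_derivative; assumption)+
  then have "isCont A p" "isCont B p"
    using assms(1,2) by (auto dest!: smooth_on_continuous simp: continuous_on_eq_continuous_at)
  have le: "\<bar>A p - B p\<bar> \<le> e" if "e > 0" for e
  proof -
    obtain a where a: "a > 0" "\<And>x. dist x p < a \<Longrightarrow> dist (A x) (A p) < e / 2"
      using \<open>isCont A p\<close> \<open>e > 0\<close> unfolding continuous_at_eps_delta by (meson half_gt_zero)
    obtain b where b: "b > 0" "\<And>x. dist x p < b \<Longrightarrow> dist (B x) (B p) < e / 2"
      using \<open>isCont B p\<close> \<open>e > 0\<close> unfolding continuous_at_eps_delta by (meson half_gt_zero)
    obtain c where c: "c > 0" "ball p c \<subseteq> S"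
      using assms(1,2) openE by blast
    define \<delta> where "\<delta> = min a (min b c)"
    define N where "N = norm v + norm w + 1"
    \<comment> \<open>The parallelogram with sides \<open>h\<close> times \<open>v\<close> and
      \<open>w\<close> must lie within \<open>\<delta>\<close> of \<open>p\<close>; the summand 1 in
      \<open>N\<close> keeps the divisor positive even when \<open>v\<close> and \<open>w\<close>
      vanish.\<close>
    define h where "h = \<delta> / (2 * N)"
    have \<delta>: "\<delta> > 0" using a b c by (simp add: \<delta>_def)
    have pos: "N > 0"
      using norm_ge_zero[of v] norm_ge_zero[of w] unfolding N_def by linarith
    have h: "h > 0" using \<delta> pos by (simp add: h_def)
    have "h * N = \<delta> / 2"
      using pos by (simp add: h_def)
    then have small: "h * (norm v + norm w) < \<delta>"
      using h \<delta> by (simp add: N_def algebra_simps)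
    have near: "dist (p + s *\<^sub>R v + t *\<^sub>R w) p < \<delta>" if "0 \<le> s" "s \<le> h" "0 \<le> t" "t \<le> h" for s t
    proof -
      have "dist (p + s *\<^sub>R v + t *\<^sub>R w) p \<le> norm (s *\<^sub>R v) + norm (t *\<^sub>R w)"
        by (metis add.assoc add_diff_cancel_left' dist_norm norm_triangle_ineq)
      also have "\<dots> \<le> h * norm v + h * norm w"
        using that by (intro add_mono) (auto intro: mult_right_mono)
      finally show ?thesis using small by (simp add: algebra_simps)
    qed
    then have S: "p + s *\<^sub>R v + t *\<^sub>R w \<in> S" if "0 \<le> s" "s \<le> h" "0 \<le> t" "t \<le> h" for s t
      using that c by (fastforce simp: \<delta>_def dist_commute)
    then have S': "p + s *\<^sub>R w + t *\<^sub>R v \<in> S" if "0 \<le> s" "s \<le> h" "0 \<le> t" "t \<le> h" for s t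
      using that by (metis add.assoc add.commute)
    have diff: "\<And>x. x \<in> S \<Longrightarrow> u differentiable (at x)"
      "\<And>x z. x \<in> S \<Longrightarrow> (\<lambda>x. frechet_derivative u (at x) z) differentiable (at x)"
      using assms(3) by (blast intro: smooth_on_differentiable smooth_on_frechet_derivative)+
    obtain s t where st: "0 < s" "s < h" "0 < t" "t < h"
      "u (p + h *\<^sub>R v + h *\<^sub>R w) - u (p + h *\<^sub>R v) - u (p + h *\<^sub>R w) + u p =
        h\<^sup>2 * A (p + s *\<^sub>R v + t *\<^sub>R w)"
      unfolding A_def by (rule second_difference_mvt[OF h S diff])
    obtain s' t' where st': "0 < s'" "s' < h" "0 < t'" "t' < h"
      "u (p + h *\<^sub>R w + h *\<^sub>R v) - u (p + h *\<^sub>R w) - u (p + h *\<^sub>R v) + u p =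
        h\<^sup>2 * B (p + s' *\<^sub>R w + t' *\<^sub>R v)"
      unfolding B_def by (rule second_difference_mvt[OF h S' diff])
    \<comment> \<open>Reordering the summands shows that both expansions have the same second
      difference on the left.\<close>
    have swap: "p + s' *\<^sub>R w + t' *\<^sub>R v = p + t' *\<^sub>R v + s' *\<^sub>R w"
      "p + h *\<^sub>R w + h *\<^sub>R v = p + h *\<^sub>R v + h *\<^sub>R w"
      by (simp_all add: algebra_simps)
    have "h\<^sup>2 * A (p + s *\<^sub>R v + t *\<^sub>R w) = h\<^sup>2 * B (p + t' *\<^sub>R v + s' *\<^sub>R w)"
      using st(5) st'(5) unfolding swap by linarith
    then have eq: "A (p + s *\<^sub>R v + t *\<^sub>R w) = B (p + t' *\<^sub>R v + s' *\<^sub>R w)"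
      using h by simp
    have "dist (A (p + s *\<^sub>R v + t *\<^sub>R w)) (A p) < e / 2"
      using near[of s t] st by (intro a) (auto simp: \<delta>_def)
    moreover have "dist (B (p + t' *\<^sub>R v + s' *\<^sub>R w)) (B p) < e / 2"
      using near[of t' s'] st' by (intro b) (auto simp: \<delta>_def)
    ultimately show ?thesis unfolding eq dist_real_def by linarith
  qed
  have "\<bar>A p - B p\<bar> \<le> 0"
    by (rule field_le_epsilon, unfold add_0, rule le)
  then show ?thesis by (simp add: A_def B_def)
qed


section \<open>Horizontal vector fields\<close>

text \<open>The direction of \<open>X\<close> varies with the base point, whereas iterated
  derivatives are controlled along fixed vectors. Linearity moves the variation into a
  coefficient.\<close>

lemma X_field_eq:
  assumes "u differentiable (at p)"
  shows "X_field u p = frechet_derivative u (at p) (1, 0) +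
    (2 * Im (fst p)) *\<^sub>R frechet_derivative u (at p) (0, 1)"
proof -
  interpret linear "frechet_derivative u (at p)"
    using assms by (rule linear_frechet_derivative)
  have "(1, 2 * Im (fst p)) = (1, 0) + (2 * Im (fst p)) *\<^sub>R ((0, 1) :: heis)" by simp
  then show ?thesis unfolding X_field_def by (metis add scaleR)
qed

lemma Y_field_eq:
  assumes "u differentiable (at p)"
  shows "Y_field u p = frechet_derivative u (at p) (\<i>, 0) +
    (- 2 * Re (fst p)) *\<^sub>R frechet_derivative u (at p) (0, 1)"
proof -
  interpret linear "frechet_derivative u (at p)"
    using assms by (rule linear_frechet_derivative)
  have "(\<i>, - 2 * Re (fst p)) = (\<i>, 0) + (- 2 * Re (fst p)) *\<^sub>R ((0, 1) :: heis)" by simp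
  then show ?thesis unfolding Y_field_def by (metis add scaleR)
qed

lemma bounded_linear_heis_coordinates:
  "bounded_linear (\<lambda>x :: heis. Re (fst x))" "bounded_linear (\<lambda>x :: heis. Im (fst x))"
  by (rule bounded_linear_compose[OF _ bounded_linear_fst], rule bounded_linear_Re bounded_linear_Im)+

lemma smooth_on_X_field:
  assumes "open S" "smooth_on S u"
  shows "smooth_on S (X_field u)"
proof (rule smooth_on_cong[OF assms(1)])
  show "frechet_derivative u (at x) (1, 0) +
    (2 * Im (fst x)) *\<^sub>R frechet_derivative u (at x) (0, 1) = X_field u x" if "x \<in> S" for x
    using X_field_eq smooth_on_differentiable assms(2) that by metis
  have "smooth_on S (\<lambda>x :: heis. 2 * Im (fst x))"
    by (intro smooth_on_linear bounded_linear_const_mult bounded_linear_heis_coordinates)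
  then show "smooth_on S (\<lambda>x. frechet_derivative u (at x) (1, 0) +
    (2 * Im (fst x)) *\<^sub>R frechet_derivative u (at x) (0, 1))"
    using assms by (intro smooth_on_add smooth_on_scaleR smooth_on_frechet_derivative)
qed

lemma smooth_on_Y_field:
  assumes "open S" "smooth_on S u"
  shows "smooth_on S (Y_field u)"
proof (rule smooth_on_cong[OF assms(1)])
  show "frechet_derivative u (at x) (\<i>, 0) +
    (- 2 * Re (fst x)) *\<^sub>R frechet_derivative u (at x) (0, 1) = Y_field u x" if "x \<in> S" for x
    using Y_field_eq smooth_on_differentiable assms(2) that by metis
  have "smooth_on S (\<lambda>x :: heis. - 2 * Re (fst x))"
    by (intro smooth_on_linear bounded_linear_const_mult bounded_linear_heis_coordinates)
  then show "smooth_on S (\<lambda>x. frechet_derivative u (at x) (\<i>, 0) +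
    (- 2 * Re (fst x)) *\<^sub>R frechet_derivative u (at x) (0, 1))"
    using assms by (intro smooth_on_add smooth_on_scaleR smooth_on_frechet_derivative)
qed

lemma smooth_on_Z_field:
  assumes "open S" "smooth_on S u"
  shows "smooth_on S (Z_field u)"
proof -
  have eq: "Z_field u = (\<lambda>x. X_field u x / 2 + (- \<i> / 2) * Y_field u x)"
    by (rule ext) (simp add: Z_field_def field_simps)
  have "bounded_linear (\<lambda>z::complex. z / 2)" "bounded_linear (\<lambda>z. (- \<i> / 2) * z)"
    by (intro bounded_linear_divide bounded_linear_mult_right)+
  then show ?thesis
    unfolding eq using assms
    by (intro smooth_on_add smooth_on_X_field smooth_on_Y_field
        smooth_on_compose_linear[of S "\<lambda>z. z / 2"] smooth_on_compose_linear[of S "\<lambda>z. (- \<i> / 2) * z"])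
qed

section \<open>Derivation rules for \<open>Z\<close> and the commutator of \<open>X\<close> and
  \<open>Y\<close>\<close>

lemma Z_field_mult:
  assumes "u differentiable (at p)" "v differentiable (at p)"
  shows "Z_field (\<lambda>x. u x * v x) p = u p * Z_field v p + Z_field u p * v p"
proof -
  have "frechet_derivative (\<lambda>x. u x * v x) (at p) =
    (\<lambda>w. u p * frechet_derivative v (at p) w + frechet_derivative u (at p) w * v p)"
    using assms by (intro frechet_derivative_eqI has_derivative_mult has_frechet_derivative)
  then show ?thesis
    by (simp add: Z_field_def X_field_def Y_field_def algebra_simps add_divide_distrib diff_divide_distrib)
qed

lemma Z_field_add:
  assumes "u differentiable (at p)" "v differentiable (at p)"
  shows "Z_field (\<lambda>x. u x + v x) p = Z_field u p + Z_field v p"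
proof -
  have "frechet_derivative (\<lambda>x. u x + v x) (at p) =
    (\<lambda>w. frechet_derivative u (at p) w + frechet_derivative v (at p) w)"
    using assms by (intro frechet_derivative_eqI has_derivative_add has_frechet_derivative)
  then show ?thesis
    by (simp add: Z_field_def X_field_def Y_field_def algebra_simps add_divide_distrib diff_divide_distrib)
qed

lemma Z_field_cong:
  assumes "open S" "p \<in> S" "\<And>x. x \<in> S \<Longrightarrow> u x = v x" "v differentiable (at p)"
  shows "Z_field u p = Z_field v p"
proof -
  have "frechet_derivative v (at p) = frechet_derivative u (at p)"
    using assms by (intro frechet_derivative_transform_within_open) auto
  then show ?thesis by (simp add: Z_field_def X_field_def Y_field_def)
qed

text \<open>Second-order terms cancel by symmetry of second derivatives. What remains comes from the
  coefficients: \<open>X\<close> applied to \<open>-2x\<close> gives -2, and \<open>Y\<close>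
  applied to \<open>2y\<close> gives 2.\<close>

lemma XY_field_commutator:
  fixes u :: "heis \<Rightarrow> real"
  assumes "open S" "p \<in> S" "smooth_on S u"
  shows "X_field (Y_field u) p - Y_field (X_field u) p = - 4 * frechet_derivative u (at p) (0, 1)"
proof -
  define D where "D v x = frechet_derivative u (at x) v" for v x
  have sm: "smooth_on S (D v)" for v
    unfolding D_def using assms(3) by (rule smooth_on_frechet_derivative)
  have df: "D v differentiable (at p)" for v
    using smooth_on_differentiable[OF sm assms(2)] .
  have sym: "frechet_derivative (D v) (at p) w = frechet_derivative (D w) (at p) v" for v w
    using second_derivative_symmetric[OF assms] unfolding D_def[abs_def] by simp
  have eq: "X_field u x = D (1, 0) x + 2 * Im (fst x) * D (0, 1) x"
    "Y_field u x = D (\<i>, 0) x + (- 2 * Re (fst x)) * D (0, 1) x" if "x \<in> S" for x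
    using X_field_eq[of u x] Y_field_eq[of u x] smooth_on_differentiable[OF assms(3) that]
    by (simp_all add: D_def)
  have dX: "((\<lambda>x. D (1, 0) x + 2 * Im (fst x) * D (0, 1) x) has_derivative
    (\<lambda>w. frechet_derivative (D (1, 0)) (at p) w + (2 * Im (fst p) * frechet_derivative (D (0, 1)) (at p) w
       + 2 * Im (fst w) * D (0, 1) p))) (at p)"
    by (auto intro!: derivative_eq_intros has_frechet_derivative df)
  have dY: "((\<lambda>x. D (\<i>, 0) x + (- 2 * Re (fst x)) * D (0, 1) x) has_derivative
    (\<lambda>w. frechet_derivative (D (\<i>, 0)) (at p) w + ((- 2 * Re (fst p)) * frechet_derivative (D (0, 1)) (at p) w
       + (- 2 * Re (fst w)) * D (0, 1) p))) (at p)"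
    by (auto intro!: derivative_eq_intros has_frechet_derivative df)
  have X: "frechet_derivative (X_field u) (at p) =
    (\<lambda>w. frechet_derivative (D (1, 0)) (at p) w + (2 * Im (fst p) * frechet_derivative (D (0, 1)) (at p) w
       + 2 * Im (fst w) * D (0, 1) p))"
    by (rule frechet_derivative_eqI has_derivative_transform_within_open[OF dX assms(1,2)])+
      (simp add: eq)
  have Y: "frechet_derivative (Y_field u) (at p) =
    (\<lambda>w. frechet_derivative (D (\<i>, 0)) (at p) w + ((- 2 * Re (fst p)) * frechet_derivative (D (0, 1)) (at p) w
       + (- 2 * Re (fst w)) * D (0, 1) p))"
    by (rule frechet_derivative_eqI has_derivative_transform_within_open[OF dY assms(1,2)])+
      (simp add: eq)
  have "X_field (Y_field u) p = X_field (D (\<i>, 0)) p + ((- 2 * Re (fst p)) * X_field (D (0, 1)) p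
       - 2 * D (0, 1) p)"
    by (simp add: X_field_def Y)
  moreover have "Y_field (X_field u) p = Y_field (D (1, 0)) p + (2 * Im (fst p) * Y_field (D (0, 1)) p
       + 2 * D (0, 1) p)"
    by (simp add: Y_field_def X)
  \<comment> \<open>The three instances of symmetry are the coordinate pairs y and x, y and t, x and
    t; the pure second t-derivative has the same coefficient in both products and drops out.\<close>
  ultimately have "X_field (Y_field u) p - Y_field (X_field u) p = - 4 * D (0, 1) p"
    using sym[of "(\<i>, 0)" "(1, 0)"] sym[of "(\<i>, 0)" "(0, 1)"] sym[of "(1, 0)" "(0, 1)"]
    unfolding X_field_eq[OF df] Y_field_eq[OF df]
    by (simp add: algebra_simps)
  then show ?thesis by (simp add: D_def)
qed


section \<open>Contact mappings\<close>

text \<open>This is the contact equation solved for the differential of the third component, in the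
  form in which it can be evaluated on \<open>X\<close>, \<open>Y\<close> and the
  t-direction.\<close>

lemma contact_map_components:
  assumes "smooth_on \<Omega> f" "contact_with \<Omega> f lam" "p \<in> \<Omega>"
  shows "frechet_derivative (\<lambda>p. snd (f p)) (at p) v =
     2 * Im (fst (f p)) * frechet_derivative (\<lambda>p. Re (fst (f p))) (at p) v
     - 2 * Re (fst (f p)) * frechet_derivative (\<lambda>p. Im (fst (f p))) (at p) v + lam p * theta p v"
proof -
  have f: "(f has_derivative frechet_derivative f (at p)) (at p)"
    using assms(1,3) by (intro has_frechet_derivative smooth_on_differentiable)
  have 1: "frechet_derivative (\<lambda>p. Re (fst (f p))) (at p) = (\<lambda>v. Re (fst (frechet_derivative f (at p) v)))"
   and 2: "frechet_derivative (\<lambda>p. Im (fst (f p))) (at p) = (\<lambda>v. Im (fst (frechet_derivative f (at p) v)))"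
   and 3: "frechet_derivative (\<lambda>p. snd (f p)) (at p) = (\<lambda>v. snd (frechet_derivative f (at p) v))"
    using f by (auto intro!: frechet_derivative_eqI derivative_eq_intros)
  have "theta_pullback f p v = lam p * theta p v"
    using assms(2,3) unfolding contact_with_def by blast
  then show ?thesis unfolding 1 2 3 theta_pullback_def theta_def by simp
qed

lemma theta_horizontal:
  "theta p (1, 2 * Im (fst p)) = 0" "theta p (\<i>, - 2 * Re (fst p)) = 0"
  by (simp_all add: theta_def)

text \<open>The contact equation expresses \<open>X f\<^sub>3\<close> and \<open>Y f\<^sub>3\<close> through the other two components; applying
  \<open>[X, Y] = -4 \<partial>\<^sub>t\<close> to \<open>f\<^sub>1, f\<^sub>2, f\<^sub>3\<close> gives the factor, which is the value of the pullback of
  \<open>\<theta>\<close> at \<open>\<partial>\<^sub>t\<close>.\<close>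

lemma contact_factor_eq:
  fixes f :: "heis \<Rightarrow> heis" and \<Omega> :: "heis set"
  defines "f1 \<equiv> \<lambda>p. Re (fst (f p))" and "f2 \<equiv> \<lambda>p. Im (fst (f p))"
  assumes "open \<Omega>" "smooth_on \<Omega> f" "contact_with \<Omega> f lam" "p \<in> \<Omega>"
  shows "lam p = X_field f1 p * Y_field f2 p - X_field f2 p * Y_field f1 p"
proof -
  define f3 where "f3 = (\<lambda>p. snd (f p))"
  have sm: "smooth_on \<Omega> f1" "smooth_on \<Omega> f2" "smooth_on \<Omega> f3"
    unfolding f1_def f2_def f3_def using assms(3,4)
    by (auto intro: smooth_on_compose_linear[of \<Omega> _ f] bounded_linear_heis_coordinates
        bounded_linear_snd)
  note comp = contact_map_components[OF assms(4,5), folded f1_def f2_def f3_def]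
  \<comment> \<open>On horizontal vectors \<open>theta\<close> vanishes, so the unknown factor
    disappears; the identities hold throughout the open set and can therefore be differentiated
    again.\<close>
  have X3: "X_field f3 x = 2 * f2 x * X_field f1 x - 2 * f1 x * X_field f2 x"
    and Y3: "Y_field f3 x = 2 * f2 x * Y_field f1 x - 2 * f1 x * Y_field f2 x" if "x \<in> \<Omega>" for x
    using comp[OF that] theta_horizontal[of x] by (simp_all add: X_field_def Y_field_def f1_def f2_def)
  \<comment> \<open>In the t-direction \<open>theta\<close> equals 1, so here the factor
    survives.\<close>
  have T3: "frechet_derivative f3 (at p) (0, 1) = 2 * f2 p * frechet_derivative f1 (at p) (0, 1)
      - 2 * f1 p * frechet_derivative f2 (at p) (0, 1) + lam p"
    using comp[OF assms(6)] by (simp add: f1_def f2_def theta_def)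
  have D: "(u has_derivative frechet_derivative u (at p)) (at p)" if "smooth_on \<Omega> u" for u :: "heis \<Rightarrow> real"
    using that assms(6) by (intro has_frechet_derivative smooth_on_differentiable)
  note DX = D[OF smooth_on_X_field[OF assms(3)]] and DY = D[OF smooth_on_Y_field[OF assms(3)]]
  have "((\<lambda>x. 2 * f2 x * Y_field f1 x - 2 * f1 x * Y_field f2 x) has_derivative
      (\<lambda>v. 2 * (f2 p * frechet_derivative (Y_field f1) (at p) v + frechet_derivative f2 (at p) v * Y_field f1 p)
        - 2 * (f1 p * frechet_derivative (Y_field f2) (at p) v + frechet_derivative f1 (at p) v * Y_field f2 p)))
      (at p)"
    by (rule derivative_eq_intros D DY sm refl)+ (simp add: algebra_simps)
  from has_derivative_transform_within_open[OF this assms(3,6)]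
  have XY: "X_field (Y_field f3) p =
      2 * (f2 p * X_field (Y_field f1) p + X_field f2 p * Y_field f1 p)
        - 2 * (f1 p * X_field (Y_field f2) p + X_field f1 p * Y_field f2 p)"
    by (subst X_field_def, subst frechet_derivative_eqI) (auto simp: Y3 X_field_def)
  have "((\<lambda>x. 2 * f2 x * X_field f1 x - 2 * f1 x * X_field f2 x) has_derivative
      (\<lambda>v. 2 * (f2 p * frechet_derivative (X_field f1) (at p) v + frechet_derivative f2 (at p) v * X_field f1 p)
        - 2 * (f1 p * frechet_derivative (X_field f2) (at p) v + frechet_derivative f1 (at p) v * X_field f2 p)))
      (at p)"
    by (rule derivative_eq_intros D DX sm refl)+ (simp add: algebra_simps)
  from has_derivative_transform_within_open[OF this assms(3,6)]
  have YX: "Y_field (X_field f3) p =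
      2 * (f2 p * Y_field (X_field f1) p + Y_field f2 p * X_field f1 p)
        - 2 * (f1 p * Y_field (X_field f2) p + Y_field f1 p * X_field f2 p)"
    by (subst Y_field_def, subst frechet_derivative_eqI) (auto simp: X3 Y_field_def)
  note comm = XY_field_commutator[OF assms(3,6)]
  have c1: "X_field (Y_field f1) p = Y_field (X_field f1) p - 4 * frechet_derivative f1 (at p) (0, 1)"
    and c2: "X_field (Y_field f2) p = Y_field (X_field f2) p - 4 * frechet_derivative f2 (at p) (0, 1)"
    using comm[OF sm(1)] comm[OF sm(2)] by linarith+
  \<comment> \<open>The t-derivatives of \<open>f1\<close> and \<open>f2\<close> cancel. The
    horizontal Jacobian occurs with total coefficient -4, matching the -4 in front of
    \<open>lam p\<close>.\<close>
  from comm[OF sm(3)] show ?thesis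
    unfolding XY YX T3 c1 c2 by (simp add: algebra_simps)
qed

text \<open>Differentiation commutes with the linear maps \<open>fst\<close>, \<open>Re\<close> and
  \<open>Im\<close>. This links the contact factor, expressed in real components, to
  \<open>Z\<close>, which acts on the complex component.\<close>

lemma XY_field_fst_components:
  assumes "f differentiable (at p)"
  shows "X_field (fst \<circ> f) p = Complex (X_field (\<lambda>p. Re (fst (f p))) p) (X_field (\<lambda>p. Im (fst (f p))) p)"
    and "Y_field (fst \<circ> f) p = Complex (Y_field (\<lambda>p. Re (fst (f p))) p) (Y_field (\<lambda>p. Im (fst (f p))) p)"
proof -
  have f: "(f has_derivative frechet_derivative f (at p)) (at p)"
    using assms by (rule has_frechet_derivative)
  have "frechet_derivative (\<lambda>p. Re (fst (f p))) (at p) = (\<lambda>v. Re (fst (frechet_derivative f (at p) v)))"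
   "frechet_derivative (\<lambda>p. Im (fst (f p))) (at p) = (\<lambda>v. Im (fst (frechet_derivative f (at p) v)))"
   "frechet_derivative (fst \<circ> f) (at p) = (\<lambda>v. fst (frechet_derivative f (at p) v))"
    using f by (auto intro!: frechet_derivative_eqI derivative_eq_intros simp: o_def)
  then show "X_field (fst \<circ> f) p = Complex (X_field (\<lambda>p. Re (fst (f p))) p) (X_field (\<lambda>p. Im (fst (f p))) p)"
    "Y_field (fst \<circ> f) p = Complex (Y_field (\<lambda>p. Re (fst (f p))) p) (Y_field (\<lambda>p. Im (fst (f p))) p)"
    by (simp_all add: X_field_def Y_field_def)
qed

text \<open>If \<open>Z F\<close> vanished, the real components would satisfy the anti-holomorphic
  Cauchy--Riemann equations, and the contact factor would be minus a sum of two squares.\<close>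

lemma Z_field_pos_contact_nonzero:
  assumes "open \<Omega>" "smooth_on \<Omega> f" "pos_contact_map \<Omega> f" "p \<in> \<Omega>"
  shows "Z_field (fst \<circ> f) p \<noteq> 0"
proof
  obtain lam where lam: "contact_with \<Omega> f lam" "lam p > 0"
    using assms(3,4) by (auto simp: pos_contact_map_def)
  define A where "A = X_field (\<lambda>p. Re (fst (f p))) p"
  define B where "B = X_field (\<lambda>p. Im (fst (f p))) p"
  define C where "C = Y_field (\<lambda>p. Re (fst (f p))) p"
  define D where "D = Y_field (\<lambda>p. Im (fst (f p))) p"
  have pos: "A * D - B * C > 0"
    using lam(2) contact_factor_eq[OF assms(1,2) lam(1) assms(4)] by (simp add: A_def B_def C_def D_def)
  assume "Z_field (fst \<circ> f) p = 0"
  then have "Complex A B - \<i> * Complex C D = 0"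
    using XY_field_fst_components[OF smooth_on_differentiable[OF assms(2,4)]]
    by (simp add: Z_field_def A_def B_def C_def D_def)
  then have "D = - A" "C = B" by (auto simp: complex_eq_iff)
  with pos have "A * A + B * B < 0" by simp
  then show False using sum_squares_ge_zero[of A B] by linarith
qed

text \<open>With \<open>\<lambda> = X g\<^sub>1 Y g\<^sub>2 - X g\<^sub>2 Y g\<^sub>1\<close> positive, conformality forces
  \<open>\<lambda> = (X g\<^sub>1)\<^sup>2 + (X g\<^sub>2)\<^sup>2\<close>; the equation \<open>Y G = i X G\<close> says that the conjugate field
  \<open>(X + i Y) / 2\<close> annihilates \<open>G\<close>.\<close>

lemma conformal_Cauchy_Riemann:
  assumes "open \<Omega>" "smooth_on \<Omega> g" "pos_contact_map \<Omega> g" "conformal_map \<Omega> g" "p \<in> \<Omega>"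
  shows "Y_field (fst \<circ> g) p = \<i> * X_field (fst \<circ> g) p"
proof -
  obtain lam where lam: "contact_with \<Omega> g lam" "lam p > 0"
    using assms(3,5) by (auto simp: pos_contact_map_def)
  define A where "A = X_field (\<lambda>p. Re (fst (g p))) p"
  define B where "B = X_field (\<lambda>p. Im (fst (g p))) p"
  define C where "C = Y_field (\<lambda>p. Re (fst (g p))) p"
  define D where "D = Y_field (\<lambda>p. Im (fst (g p))) p"
  have pos: "A * D - B * C > 0"
    using lam(2) contact_factor_eq[OF assms(1,2) lam(1) assms(5)] by (simp add: A_def B_def C_def D_def)
  have conf: "A\<^sup>2 + B\<^sup>2 = C\<^sup>2 + D\<^sup>2" "A * C + B * D = 0"
    using assms(4,5) by (simp_all add: conformal_map_def Let_def A_def B_def C_def D_def)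
  \<comment> \<open>Lagrange's identity: the squared determinant is the Gram determinant of the rows
    \<open>(A, B)\<close> and \<open>(C, D)\<close>, which conformality makes orthogonal and of
    equal length.\<close>
  have "(A * D - B * C)\<^sup>2 = (A\<^sup>2 + B\<^sup>2) * (C\<^sup>2 + D\<^sup>2) - (A * C + B * D)\<^sup>2"
    by (simp add: power2_eq_square algebra_simps)
  also have "\<dots> = (A\<^sup>2 + B\<^sup>2)\<^sup>2"
    using conf by (simp add: power2_eq_square)
  \<comment> \<open>Positivity of the contact factor selects the sign of the square root.\<close>
  finally have "A * D - B * C = A\<^sup>2 + B\<^sup>2"
    using pos by (simp add: power2_eq_iff_nonneg)
  then have "(A - D)\<^sup>2 + (B + C)\<^sup>2 = 0"
    using conf(1) by (simp add: power2_eq_square algebra_simps)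
  then have "D = A" "C = - B"
    by (simp_all add: sum_power2_eq_zero_iff)
  then show ?thesis
    using XY_field_fst_components[OF smooth_on_differentiable[OF assms(2,5)]]
    by (simp add: complex_eq_iff A_def B_def C_def D_def)
qed

text \<open>A contact map preserves the horizontal plane spanned by \<open>X\<close> and \<open>Y\<close>, and the
  Cauchy--Riemann equation removes the term of the chain rule in the conjugate field.\<close>

lemma Z_field_compose_conformal:
  assumes "open \<Omega>" "smooth_on \<Omega> g" "pos_contact_map \<Omega> g" "conformal_map \<Omega> g" "p \<in> \<Omega>"
    and u: "u differentiable (at (g p))"
  shows "Z_field (\<lambda>x. u (g x)) p = Z_field (fst \<circ> g) p * Z_field u (g p)"
proof -
  obtain lam where lam: "contact_with \<Omega> g lam"
    using assms(3) by (auto simp: pos_contact_map_def)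
  define V where "V = frechet_derivative g (at p) (1, 2 * Im (fst p))"
  define W where "W = frechet_derivative g (at p) (\<i>, - 2 * Re (fst p))"
  have g: "g differentiable (at p)" using assms(2,5) by (rule smooth_on_differentiable)
  have "frechet_derivative (fst \<circ> g) (at p) = (\<lambda>v. fst (frechet_derivative g (at p) v))"
    using has_frechet_derivative[OF g]
    by (auto intro!: frechet_derivative_eqI derivative_eq_intros simp: o_def)
  then have fst: "fst V = X_field (fst \<circ> g) p" "fst W = Y_field (fst \<circ> g) p"
    by (simp_all add: X_field_def Y_field_def V_def W_def)
  have "fst W = \<i> * fst V"
    using conformal_Cauchy_Riemann[OF assms(1-5)] fst by simp
  then have fstW: "Re (fst W) = - Im (fst V)" "Im (fst W) = Re (fst V)" by simp_all
  have "theta (g p) V = 0" "theta (g p) W = 0"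
    using lam assms(5) theta_horizontal[of p]
    unfolding contact_with_def theta_pullback_def V_def W_def by auto
  \<comment> \<open>A vector annihilated by \<open>theta\<close> is determined by its complex part,
    which supplies its coordinates in the frame \<open>X\<close>, \<open>Y\<close> at
    \<open>g p\<close>. Cauchy--Riemann turns the coordinates of \<open>W\<close> into those of
    \<open>V\<close> rotated by a right angle.\<close>
  then have V: "V = Re (fst V) *\<^sub>R (1, 2 * Im (fst (g p))) + Im (fst V) *\<^sub>R (\<i>, - 2 * Re (fst (g p)))"
    and W: "W = (- Im (fst V)) *\<^sub>R (1, 2 * Im (fst (g p))) + Re (fst V) *\<^sub>R (\<i>, - 2 * Re (fst (g p)))"
    using fstW by (auto simp: theta_def prod_eq_iff complex_eq_iff algebra_simps)
  interpret linear "frechet_derivative u (at (g p))"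
    using u by (rule linear_frechet_derivative)
  have "frechet_derivative (\<lambda>x. u (g x)) (at p) =
      (\<lambda>v. frechet_derivative u (at (g p)) (frechet_derivative g (at p) v))"
    using frechet_derivative_compose[OF g u] by (simp add: o_def)
  then have comp: "X_field (\<lambda>x. u (g x)) p = frechet_derivative u (at (g p)) V"
    "Y_field (\<lambda>x. u (g x)) p = frechet_derivative u (at (g p)) W"
    by (simp_all add: X_field_def Y_field_def V_def W_def)
  have XG: "frechet_derivative u (at (g p)) V = Re (fst V) *\<^sub>R X_field u (g p) + Im (fst V) *\<^sub>R Y_field u (g p)"
    using arg_cong[OF V, of "frechet_derivative u (at (g p))"]
    unfolding X_field_def Y_field_def add scaleR .
  have YG: "frechet_derivative u (at (g p)) W = (- Im (fst V)) *\<^sub>R X_field u (g p) + Re (fst V) *\<^sub>R Y_field u (g p)"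
    using arg_cong[OF W, of "frechet_derivative u (at (g p))"]
    unfolding X_field_def Y_field_def add scaleR .
  have ZG: "Z_field (fst \<circ> g) p = fst V"
    using \<open>fst W = \<i> * fst V\<close> fst by (simp add: Z_field_def)
  show ?thesis
    \<comment> \<open>With \<open>fst V\<close> equal to \<open>r + i s\<close>, the coefficient of
      \<open>X u\<close> is \<open>(r + i s) / 2\<close> and that of \<open>Y u\<close> is
      \<open>(s - i r) / 2\<close>, which is \<open>-i\<close> times the former.\<close>
    unfolding ZG Z_field_def[of u] Z_field_def[of "\<lambda>x. u (g x)"] comp XG YG
    by (simp add: complex_eq_iff algebra_simps)
qed


section \<open>The chain rule\<close>

theorem lemma6p2:
  fixes \<Omega> \<Omega>' :: "heis set" and f g :: "heis \<Rightarrow> heis"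
  assumes "open \<Omega>" and "open \<Omega>'"
    and "smooth_on \<Omega> f" and "pos_contact_map \<Omega> f"
    and "g ` \<Omega>' \<subseteq> \<Omega>"
    and "smooth_on \<Omega>' g" and "pos_contact_map \<Omega>' g" and "conformal_map \<Omega>' g"
  shows "\<forall>p\<in>\<Omega>'. S_CL (f \<circ> g) p = S_CL f (g p) * (Z_field (fst \<circ> g) p)\<^sup>2 + S_CL g p"
proof
  fix p assume p: "p \<in> \<Omega>'"
  define F where "F = fst \<circ> f"
  define a where "a = Z_field (fst \<circ> g)"
  define b where "b = Z_field F"
  have smF: "smooth_on \<Omega> F"
    unfolding F_def o_def by (rule smooth_on_compose_linear[OF assms(1) bounded_linear_fst assms(3)])
  have smG: "smooth_on \<Omega>' (fst \<circ> g)"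
    unfolding o_def by (rule smooth_on_compose_linear[OF assms(2) bounded_linear_fst assms(6)])
  note smZ = smooth_on_Z_field[OF assms(1)] and smZ' = smooth_on_Z_field[OF assms(2)]
  have sm: "smooth_on \<Omega> b" "smooth_on \<Omega> (Z_field b)" "smooth_on \<Omega>' a" "smooth_on \<Omega>' (Z_field a)"
    unfolding a_def b_def by (intro smZ smZ' smF smG)+
  have da: "a differentiable (at x)" "Z_field a differentiable (at x)" if "x \<in> \<Omega>'" for x
    using that sm by (auto intro: smooth_on_differentiable)
  have dg: "g differentiable (at x)" if "x \<in> \<Omega>'" for x
    using that assms(6) smooth_on_differentiable by blast
  have du: "u differentiable (at (g x))" if "x \<in> \<Omega>'" "smooth_on \<Omega> u" for x and u :: "heis \<Rightarrow> complex"
    using that assms(5) smooth_on_differentiable by blast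
  have dug: "(\<lambda>x. u (g x)) differentiable (at x)" if "x \<in> \<Omega>'" "smooth_on \<Omega> u"
    for x and u :: "heis \<Rightarrow> complex"
    using differentiable_chain_at[OF dg[OF that(1)] du[OF that]] by (simp add: o_def)
  \<comment> \<open>Stated for every smooth \<open>u\<close> because it is applied in turn to
    \<open>F\<close>, \<open>b\<close> and \<open>Z_field b\<close>.\<close>
  have chain: "Z_field (\<lambda>x. u (g x)) x = a x * Z_field u (g x)" if "x \<in> \<Omega>'" "smooth_on \<Omega> u"
    for x and u :: "heis \<Rightarrow> complex"
    unfolding a_def using Z_field_compose_conformal[OF assms(2,6-8)] that du by blast
  \<comment> \<open>This identity and the next are proved on all of \<open>\<Omega>'\<close>, not
    just at \<open>p\<close>, since each is differentiated once more.\<close>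
  have Z1: "Z_field (fst \<circ> (f \<circ> g)) x = a x * b (g x)" if "x \<in> \<Omega>'" for x
    using chain[OF that smF] by (simp add: F_def b_def o_def)
  have Z2: "Z_field (Z_field (fst \<circ> (f \<circ> g))) x =
      a x * (a x * Z_field b (g x)) + Z_field a x * b (g x)" if x: "x \<in> \<Omega>'" for x
  proof -
    have "Z_field (Z_field (fst \<circ> (f \<circ> g))) x = Z_field (\<lambda>x. a x * b (g x)) x"
      using x Z1 da dug sm by (intro Z_field_cong[OF assms(2)] differentiable_mult) auto
    then show ?thesis
      using x da dug sm chain by (simp add: Z_field_mult)
  qed
  have "Z_field (Z_field (Z_field (fst \<circ> (f \<circ> g)))) p =
      Z_field (\<lambda>x. a x * (a x * Z_field b (g x)) + Z_field a x * b (g x)) p"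
    using p Z2 da dug sm by (intro Z_field_cong[OF assms(2)] differentiable_mult differentiable_add) auto
  \<comment> \<open>Collected, with \<open>b\<close> and its derivatives taken at
    \<open>g p\<close>: the cube of \<open>a\<close> times \<open>Z Z b\<close>, plus
    \<open>3 a (Z a) (Z b)\<close>, plus \<open>(Z Z a) b\<close>.\<close>
  also have "\<dots> = a p * (a p * (a p * Z_field (Z_field b) (g p)) + Z_field a p * Z_field b (g p))
      + Z_field a p * (a p * Z_field b (g p))
      + (Z_field a p * (a p * Z_field b (g p)) + Z_field (Z_field a) p * b (g p))"
    using p da dug sm chain by (simp add: Z_field_mult Z_field_add differentiable_mult)
  finally have Z3: "Z_field (Z_field (Z_field (fst \<circ> (f \<circ> g)))) p = \<dots>" .
  have nz: "a p \<noteq> 0" "b (g p) \<noteq> 0"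
    unfolding a_def b_def F_def
    using Z_field_pos_contact_nonzero[OF assms(2,6,7) p]
      Z_field_pos_contact_nonzero[OF assms(1,3,4), of "g p"] p assms(5) by auto
  have Sf: "S_CL f (g p) = Z_field (Z_field b) (g p) / b (g p) - 3 / 2 * (Z_field b (g p) / b (g p))\<^sup>2"
    and Sg: "S_CL g p = Z_field (Z_field a) p / a p - 3 / 2 * (Z_field a p / a p)\<^sup>2"
    by (simp_all add: S_CL_def Let_def a_def b_def F_def)
  show "S_CL (f \<circ> g) p = S_CL f (g p) * (Z_field (fst \<circ> g) p)\<^sup>2 + S_CL g p"
    unfolding S_CL_def[of "f \<circ> g"] Let_def Z3 Z2[OF p] Z1[OF p] a_def[symmetric] Sf Sg
    \<comment> \<open>After division by \<open>a b\<close> the third-order quotient contains the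
      mixed term \<open>3 (Z a) (Z b) / b\<close>. The square of
      \<open>a (Z b) / b + (Z a) / a\<close>, weighted by 3/2, contains the same term, so the
      difference splits into the two Schwarzians.\<close>
    using nz by (simp add: field_simps power2_eq_square)
qed

end
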